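(* Let $r,s\in\mathbb{C}^*$ be roots of unity with $r^2\neq s^2$, and let $\epsilon=(\epsilon_1,\epsilon_2,\epsilon_3)\in(\mathbb{C}^* )^3$. Then $\mathcal{M}_3(\epsilon)$ is a simple $\mathcal{B}$-module of dimension $\ell$, where $\ell=\operatorname{lcm}(\operatorname{ord}(rs),\operatorname{ord}(rs^{-1}))$.
   Context: $\mathcal{B}$ is the $\mathbb{C}$-algebra generated by $X_1,X_2,X_3,\tilde W$ with defining relations $$\tilde WX_1=r^{-2}X_1\tilde W,\quad X_2X_1=s^{-2}X_1X_2,\quad X_3X_1=(rs)^{-2}X_1X_3,\quad X_3X_2=(rs)^{-1}X_2X_3,$$ $$\tilde WX_3=rsX_3\tilde W,\quad \tilde WX_2=X_2\tilde W+s^2(r^2-s^2)X_3X_1.$$ (It is a subalgebra of the two-parameter quantized algebra $U^+_{r,s}(B_2)$.) All modules are right modules; $\operatorname{ord}(z)$ is the multiplicative order of $z$. $\mathcal{M}_3(\epsilon)$ is the vector space with basis $\{e(a):0\le a\le\ell-1\}$ and action ($\oplus$ is addition modulo $\ell$) $$e(a)X_1=\epsilon_1^2\epsilon_3\epsilon_2^{-1}\frac{1-rs^{-1}}{s^2(r^2-s^2)}s^{-2a}e(a\oplus2),\qquad e(a)X_2=\epsilon_1e(a\oplus1),$$ $$e(a)X_3=(rs)^a\epsilon_2e(a),\qquad e(a)\tilde W=\epsilon_1\epsilon_3(rs^{-1})^ae(a\oplus1).$$ *)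

theory Defs
  imports
    "HOL-Algebra.Multiplicative_Group"
    "HOL-Algebra.QuotRing"
    "HOL-Library.Poly_Mapping"
    "Jordan_Normal_Form.VS_Connect"
begin

section \<open>Associative algebras and right modules\<close>

text \<open>The locale \<open>algebra\<close> of HOL-Algebra is restricted to commutative algebras, and its modules to
  modules over commutative rings. The following two locales are the noncommutative versions.\<close>

locale assoc_algebra = module K A + A: ring A for K (structure) and A (structure) +
  assumes smult_mult_left:
      "\<lbrakk>c \<in> carrier K; a \<in> carrier A; b \<in> carrier A\<rbrakk>
        \<Longrightarrow> (c \<odot>\<^bsub>A\<^esub> a) \<otimes>\<^bsub>A\<^esub> b = c \<odot>\<^bsub>A\<^esub> (a \<otimes>\<^bsub>A\<^esub> b)"
    and smult_mult_right:
      "\<lbrakk>c \<in> carrier K; a \<in> carrier A; b \<in> carrier A\<rbrakk>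
        \<Longrightarrow> a \<otimes>\<^bsub>A\<^esub> (c \<odot>\<^bsub>A\<^esub> b) = c \<odot>\<^bsub>A\<^esub> (a \<otimes>\<^bsub>A\<^esub> b)"

locale right_module = A: assoc_algebra K A + M: module K M
  for K :: "('k, 'k0) ring_scheme" and A :: "('k, 'a, 'a0) module_scheme"
    and M :: "('k, 'm, 'm0) module_scheme" +
  fixes act :: "'m \<Rightarrow> 'a \<Rightarrow> 'm"
  assumes act_closed: "\<lbrakk>x \<in> carrier M; a \<in> carrier A\<rbrakk> \<Longrightarrow> act x a \<in> carrier M"
    and act_add_left: "\<lbrakk>x \<in> carrier M; y \<in> carrier M; a \<in> carrier A\<rbrakk>
        \<Longrightarrow> act (x \<oplus>\<^bsub>M\<^esub> y) a = act x a \<oplus>\<^bsub>M\<^esub> act y a"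
    and act_add_right: "\<lbrakk>x \<in> carrier M; a \<in> carrier A; b \<in> carrier A\<rbrakk>
        \<Longrightarrow> act x (a \<oplus>\<^bsub>A\<^esub> b) = act x a \<oplus>\<^bsub>M\<^esub> act x b"
    and act_smult_left: "\<lbrakk>c \<in> carrier K; x \<in> carrier M; a \<in> carrier A\<rbrakk>
        \<Longrightarrow> act (c \<odot>\<^bsub>M\<^esub> x) a = c \<odot>\<^bsub>M\<^esub> act x a"
    and act_smult_right: "\<lbrakk>c \<in> carrier K; x \<in> carrier M; a \<in> carrier A\<rbrakk>
        \<Longrightarrow> act x (c \<odot>\<^bsub>A\<^esub> a) = c \<odot>\<^bsub>M\<^esub> act x a"
    and act_mult: "\<lbrakk>x \<in> carrier M; a \<in> carrier A; b \<in> carrier A\<rbrakk>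
        \<Longrightarrow> act x (a \<otimes>\<^bsub>A\<^esub> b) = act (act x a) b"
    and act_one: "x \<in> carrier M \<Longrightarrow> act x \<one>\<^bsub>A\<^esub> = x"

definition right_submodule ::
  "('k, 'k0) ring_scheme \<Rightarrow> ('k, 'a, 'a0) module_scheme \<Rightarrow> ('k, 'm, 'm0) module_scheme
    \<Rightarrow> ('m \<Rightarrow> 'a \<Rightarrow> 'm) \<Rightarrow> 'm set \<Rightarrow> bool" where
  "right_submodule K A M act N \<longleftrightarrow>
     LinearCombinations.submodule K N M \<and> (\<forall>x\<in>N. \<forall>a\<in>carrier A. act x a \<in> N)"

locale simple_right_module = right_module +
  assumes nonzero: "carrier M \<noteq> {\<zero>\<^bsub>M\<^esub>}"
    and no_proper_submodule:
      "right_submodule K A M act N \<Longrightarrow> N = {\<zero>\<^bsub>M\<^esub>} \<or> N = carrier M"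


section \<open>Algebras given by generators and relations\<close>

text \<open>Words are wrapped in a type of their own so that concatenation can be made the addition of a
  \<open>monoid_add\<close>. The multiplication of \<open>'g fword \<Rightarrow>\<^sub>0 complex\<close> provided by \<open>Poly_Mapping\<close> is then
  convolution with respect to concatenation, that is, the product of noncommutative polynomials
  in the letters \<open>'g\<close>.\<close>

datatype 'g fword = FWord (letters: "'g list")

instantiation fword :: (type) monoid_add
begin

definition zero_fword :: "'a fword" where
  "0 = FWord []"

definition plus_fword :: "'a fword \<Rightarrow> 'a fword \<Rightarrow> 'a fword" where
  "u + v = FWord (letters u @ letters v)"

instance
  by standard (auto simp: zero_fword_def plus_fword_def)

end

type_synonym 'g fpoly = "'g fword \<Rightarrow>\<^sub>0 complex"

definition free_gen :: "'g \<Rightarrow> 'g fpoly" where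
  "free_gen g = Poly_Mapping.single (FWord [g]) 1"

definition fscale :: "complex \<Rightarrow> 'g fpoly \<Rightarrow> 'g fpoly" where
  "fscale c p = Poly_Mapping.single 0 c * p"

definition free_algebra :: "(complex, 'g fpoly) module" where
  "free_algebra =
     \<lparr>carrier = UNIV, mult = (*), one = 1, zero = 0, add = (+), smult = fscale\<rparr>"

text \<open>The elements are the cosets of the two-sided ideal generated by \<open>Rel\<close>; a scalar \<open>c\<close> acts as
  multiplication by the coset of the constant polynomial \<open>c\<close>.\<close>

definition presented_algebra :: "'g fpoly set \<Rightarrow> (complex, 'g fpoly set) module" where
  "presented_algebra Rel =
     (let F = (free_algebra :: (complex, 'g fpoly) module); I = Idl\<^bsub>F\<^esub> Rel; Q = F Quot I in
      \<lparr>carrier = carrier Q, mult = mult Q, one = one Q, zero = zero Q, add = add Q,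
       smult = (\<lambda>c a. (I +>\<^bsub>F\<^esub> (c \<odot>\<^bsub>F\<^esub> \<one>\<^bsub>F\<^esub>)) \<otimes>\<^bsub>Q\<^esub> a)\<rparr>)"

definition presented_gen :: "'g fpoly set \<Rightarrow> 'g \<Rightarrow> 'g fpoly set" where
  "presented_gen Rel g =
     (Idl\<^bsub>free_algebra\<^esub> Rel) +>\<^bsub>free_algebra :: (complex, 'g fpoly) module\<^esub> free_gen g"


section \<open>The algebra \<open>B\<close>\<close>

datatype B_letter = LX1 | LX2 | LX3 | LW

definition B_relations :: "complex \<Rightarrow> complex \<Rightarrow> B_letter fpoly set" where
  "B_relations r s =
     (let X1 = free_gen LX1; X2 = free_gen LX2; X3 = free_gen LX3; W = free_gen LW in
      {W * X1 - fscale (r powi (-2)) (X1 * W),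
       X2 * X1 - fscale (s powi (-2)) (X1 * X2),
       X3 * X1 - fscale ((r * s) powi (-2)) (X1 * X3),
       X3 * X2 - fscale ((r * s) powi (-1)) (X2 * X3),
       W * X3 - fscale (r * s) (X3 * W),
       W * X2 - (X2 * W + fscale (s^2 * (r^2 - s^2)) (X3 * X1))})"

definition B_alg :: "complex \<Rightarrow> complex \<Rightarrow> (complex, B_letter fpoly set) module" where
  "B_alg r s = presented_algebra (B_relations r s)"

definition B_gen :: "complex \<Rightarrow> complex \<Rightarrow> B_letter \<Rightarrow> B_letter fpoly set" where
  "B_gen r s = presented_gen (B_relations r s)"


section \<open>The module \<open>M\<^sub>3(\<epsilon>)\<close>\<close>

definition root_of_unity :: "complex \<Rightarrow> bool" where
  "root_of_unity z \<longleftrightarrow> (\<exists>n::nat. n > 0 \<and> z ^ n = 1)"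

definition mult_order :: "complex \<Rightarrow> nat" where
  "mult_order z = group.ord (mult_of class_ring) z"

definition ell :: "complex \<Rightarrow> complex \<Rightarrow> nat" where
  "ell r s = lcm (mult_order (r * s)) (mult_order (r * inverse s))"

text \<open>The basis vector \<open>e(a)\<close> is the standard basis vector \<open>unit_vec (ell r s) a\<close>.\<close>

definition M3_space :: "complex \<Rightarrow> complex \<Rightarrow> (complex, complex vec) module" where
  "M3_space r s = module_vec TYPE(complex) (ell r s)"

text \<open>\<open>is_M3 r s \<epsilon>1 \<epsilon>2 \<epsilon>3 act\<close> states that \<open>act\<close> makes \<open>M3_space r s\<close> the right \<open>B\<close>-module
  \<open>M\<^sub>3(\<epsilon>\<^sub>1, \<epsilon>\<^sub>2, \<epsilon>\<^sub>3)\<close>. As the generators generate \<open>B\<close> and the vectors \<open>e(a)\<close> span, there is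
  at most one such \<open>act\<close> on the carriers; its existence is the claim that the formulas define a module.\<close>

definition is_M3 ::
  "complex \<Rightarrow> complex \<Rightarrow> complex \<Rightarrow> complex \<Rightarrow> complex
    \<Rightarrow> (complex vec \<Rightarrow> B_letter fpoly set \<Rightarrow> complex vec) \<Rightarrow> bool" where
  "is_M3 r s \<epsilon>1 \<epsilon>2 \<epsilon>3 act \<longleftrightarrow>
     right_module class_ring (B_alg r s) (M3_space r s) act \<and>
     (let \<l> = ell r s; e = unit_vec \<l> in
      \<forall>a<\<l>.
        act (e a) (B_gen r s LX1) =
          (\<epsilon>1^2 * \<epsilon>3 * inverse \<epsilon>2 * ((1 - r * inverse s) / (s^2 * (r^2 - s^2)))
            * s powi (-2 * int a)) \<cdot>\<^sub>v e ((a + 2) mod \<l>) \<and>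
        act (e a) (B_gen r s LX2) = \<epsilon>1 \<cdot>\<^sub>v e ((a + 1) mod \<l>) \<and>
        act (e a) (B_gen r s LX3) = ((r * s)^a * \<epsilon>2) \<cdot>\<^sub>v e a \<and>
        act (e a) (B_gen r s LW) = (\<epsilon>1 * \<epsilon>3 * (r * inverse s)^a) \<cdot>\<^sub>v e ((a + 1) mod \<l>))"

end

theory Submission
  imports Defs
begin

text \<open>The generators act on \<open>e(a)\<close> by weighted cyclic shifts, so the defining relations reduce to scalar
  identities for the weights. These are consistent modulo \<open>\<ell>\<close> because \<open>rs\<close>, \<open>r/s\<close> and their
  quotient \<open>s\<^sup>2\<close> are \<open>\<ell>\<close>-th roots of unity. For simplicity, let \<open>v\<close> be a nonzero vector of a
  submodule. The operators \<open>X\<^sub>3 - \<epsilon>\<^sub>2 (rs)\<^sup>i\<close> and \<open>W - \<epsilon>\<^sub>3 (r/s)\<^sup>i X\<^sub>2\<close> remove \<open>e(i)\<close> from the support of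
  \<open>v\<close>, up to a cyclic shift, and the pairs \<open>((rs)\<^sup>a, (r/s)\<^sup>a)\<close> with \<open>0 \<le> a < \<ell>\<close> are distinct. Hence the
  submodule contains some \<open>e(i)\<close>, and \<open>X\<^sub>2\<close> moves it to every other basis vector.\<close>

section \<open>Free algebras and their quotients by relations\<close>

lemma ring_free_algebra: "ring (free_algebra :: (complex, 'g fpoly) module)"
  unfolding free_algebra_def
  by (intro ringI abelian_groupI monoidI)
    (auto simp: algebra_simps intro: exI[of _ "- x" for x])

lemma free_algebra_simps [simp]:
  "carrier free_algebra = UNIV"
  "mult free_algebra = (*)"
  "one free_algebra = 1"
  "zero free_algebra = 0"
  "add free_algebra = (+)"
  "smult free_algebra = fscale"
  by (simp_all add: free_algebra_def)

text \<open>The quotient map; \<open>presented_gen\<close> is its value on a letter. Elements of the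
  quotient are handled through polynomial representatives from here on.\<close>

definition presented_coset :: "'g fpoly set \<Rightarrow> 'g fpoly \<Rightarrow> 'g fpoly set" where
  "presented_coset Rel p = (Idl\<^bsub>free_algebra\<^esub> Rel) +>\<^bsub>free_algebra :: (complex, 'g fpoly) module\<^esub> p"

lemma ideal_relations: "ideal (Idl\<^bsub>free_algebra\<^esub> Rel) (free_algebra :: (complex, 'g fpoly) module)"
  by (rule ring.genideal_ideal[OF ring_free_algebra]) simp

lemma presented_algebra_simps:
  "carrier (presented_algebra Rel) = range (presented_coset Rel)"
  "presented_coset Rel p \<otimes>\<^bsub>presented_algebra Rel\<^esub> presented_coset Rel q = presented_coset Rel (p * q)"
  "presented_coset Rel p \<oplus>\<^bsub>presented_algebra Rel\<^esub> presented_coset Rel q = presented_coset Rel (p + q)"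
  "\<one>\<^bsub>presented_algebra Rel\<^esub> = presented_coset Rel 1"
  "\<zero>\<^bsub>presented_algebra Rel\<^esub> = presented_coset Rel 0"
  "c \<odot>\<^bsub>presented_algebra Rel\<^esub> presented_coset Rel p = presented_coset Rel (fscale c p)"
proof -
  let ?F = "free_algebra :: (complex, 'a fpoly) module"
  interpret ideal "Idl\<^bsub>?F\<^esub> Rel" ?F
    by (rule ideal_relations)
  show "carrier (presented_algebra Rel) = range (presented_coset Rel)"
    by (auto simp: presented_algebra_def Let_def FactRing_simps presented_coset_def)
  show "presented_coset Rel p \<otimes>\<^bsub>presented_algebra Rel\<^esub> presented_coset Rel q
      = presented_coset Rel (p * q)"
    using rcoset_mult_add[of p q]
    by (simp add: presented_algebra_def Let_def FactRing_def presented_coset_def)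
  show "presented_coset Rel p \<oplus>\<^bsub>presented_algebra Rel\<^esub> presented_coset Rel q
      = presented_coset Rel (p + q)"
    using a_rcos_sum[of p q]
    by (simp add: presented_algebra_def Let_def FactRing_def presented_coset_def)
  show "\<one>\<^bsub>presented_algebra Rel\<^esub> = presented_coset Rel 1"
    by (simp add: presented_algebra_def Let_def FactRing_def presented_coset_def)
  show "\<zero>\<^bsub>presented_algebra Rel\<^esub> = presented_coset Rel 0"
    \<comment> \<open>The zero of the quotient ring is the ideal itself, which has to be recognised
      as the coset of 0.\<close>
    using a_coset_add_zero[OF a_subset]
    by (simp add: presented_algebra_def Let_def FactRing_def presented_coset_def)
  show "c \<odot>\<^bsub>presented_algebra Rel\<^esub> presented_coset Rel p = presented_coset Rel (fscale c p)"
    \<comment> \<open>A scalar acts as the coset of a constant polynomial, so this is the product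
      rule for \<open>fscale c 1\<close> and \<open>p\<close>.\<close>
    using rcoset_mult_add[of "fscale c 1" p]
    by (simp add: presented_algebra_def Let_def FactRing_def presented_coset_def fscale_def)
qed

lemma fscale_algebra:
  "fscale c (p + q) = fscale c p + fscale c q"
  "fscale (c + d) p = fscale c p + fscale d p"
  "fscale (c * d) p = fscale c (fscale d p)"
  "fscale 1 p = p"
  "fscale c p * q = fscale c (p * q)"
  by (simp_all add: fscale_def algebra_simps single_add mult_single flip: mult.assoc)

lemma fscale_single: "fscale c (Poly_Mapping.single w d) = Poly_Mapping.single w (c * d)"
  by (simp add: fscale_def mult_single)

text \<open>\<open>update_induct\<close> only inserts words outside the support, so every update is
  the addition of a monomial.\<close>

lemma fpoly_induct [case_names single add]:
  assumes "\<And>w c. P (Poly_Mapping.single w c)"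
    and "\<And>p q. P p \<Longrightarrow> P q \<Longrightarrow> P (p + q)"
  shows "P (p :: 'g fpoly)"
proof (induction p rule: update_induct)
  case const
  \<comment> \<open>The zero polynomial is a monomial with coefficient 0, so no separate base case
    is needed.\<close>
  show ?case
    using assms(1)[of 0 0] by simp
next
  case (update p w c)
  have "Poly_Mapping.update w c p = p + Poly_Mapping.single w c"
    using update(1)
    by (intro poly_mapping_eqI) (auto simp: lookup_update lookup_add lookup_single in_keys_iff when_def)
  then show ?case
    using assms update by simp
qed

text \<open>In \<open>fscale\<close> the constant stands on the left. That it also moves past
  \<open>p\<close> is checked on monomials, where it only changes the coefficient.\<close>

lemma fscale_mult_right: "p * fscale c q = fscale c (p * q)"
proof (induction p rule: fpoly_induct)
  case (single w d)
  show ?case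
    by (induction q rule: fpoly_induct)
      (auto simp: fscale_single mult_single distrib_left fscale_algebra(1) mult_ac)
qed (simp add: distrib_right fscale_algebra(1))

lemma ring_presented_algebra: "ring (presented_algebra Rel)"
proof (intro ringI abelian_groupI monoidI)
  fix x assume "x \<in> carrier (presented_algebra Rel)"
  then obtain p where "x = presented_coset Rel p"
    by (auto simp: presented_algebra_simps)
  then show "\<exists>y\<in>carrier (presented_algebra Rel). y \<oplus>\<^bsub>presented_algebra Rel\<^esub> x = \<zero>\<^bsub>presented_algebra Rel\<^esub>"
    by (intro bexI[of _ "presented_coset Rel (- p)"]) (simp_all add: presented_algebra_simps)
qed (auto simp: presented_algebra_simps algebra_simps)

lemma assoc_algebra_presented_algebra: "assoc_algebra class_ring (presented_algebra Rel)"
proof -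
  interpret ring "presented_algebra Rel"
    by (rule ring_presented_algebra)
  have "Module.module class_ring (presented_algebra Rel)"
    by (rule moduleI[OF class_cring.is_cring is_abelian_group])
      (auto simp: presented_algebra_simps fscale_algebra)
  then show ?thesis
    by (intro assoc_algebra.intro assoc_algebra_axioms.intro ring_presented_algebra)
      (auto simp: presented_algebra_simps fscale_algebra fscale_mult_right)
qed

section \<open>Actions of presented algebras on column vectors\<close>

text \<open>The type \<open>complex vec\<close> contains vectors of all dimensions, so linearity is
  demanded on dimension \<open>n\<close> only.\<close>

definition vec_endo :: "nat \<Rightarrow> (complex vec \<Rightarrow> complex vec) \<Rightarrow> bool" where
  "vec_endo n f \<longleftrightarrow>
     (\<forall>v\<in>carrier_vec n. f v \<in> carrier_vec n) \<and>
     (\<forall>u\<in>carrier_vec n. \<forall>v\<in>carrier_vec n. f (u + v) = f u + f v) \<and>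
     (\<forall>c. \<forall>v\<in>carrier_vec n. f (c \<cdot>\<^sub>v v) = c \<cdot>\<^sub>v f v)"

lemma vec_endoD:
  assumes "vec_endo n f" "v \<in> carrier_vec n"
  shows "f v \<in> carrier_vec n"
    "u \<in> carrier_vec n \<Longrightarrow> f (u + v) = f u + f v"
    "f (c \<cdot>\<^sub>v v) = c \<cdot>\<^sub>v f v"
  using assms unfolding vec_endo_def by auto

lemma vec_endo_zero:
  assumes "vec_endo n f"
  shows "f (0\<^sub>v n) = 0\<^sub>v n"
proof -
  have "f (0 \<cdot>\<^sub>v 0\<^sub>v n) = 0 \<cdot>\<^sub>v f (0\<^sub>v n)" "f (0\<^sub>v n) \<in> carrier_vec n"
    using vec_endoD[OF assms zero_carrier_vec] by auto
  moreover have "0 \<cdot>\<^sub>v x = 0\<^sub>v n" if "x \<in> carrier_vec n" for x :: "complex vec"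
    using that by auto
  ultimately show ?thesis
    by simp
qed

text \<open>Universal property of the free algebra: arbitrary linear operators for the letters
  extend to words and polynomials. Relations enter later, as conditions on
  \<open>poly_op\<close>.\<close>

locale letter_action =
  fixes n :: nat and op :: "'g \<Rightarrow> complex vec \<Rightarrow> complex vec"
  assumes endo: "vec_endo n (op g)"
begin

text \<open>\<open>fold\<close> applies the first letter first, as a right action requires.\<close>

definition word_op :: "'g fword \<Rightarrow> complex vec \<Rightarrow> complex vec" where
  "word_op w v = fold op (letters w) v"

text \<open>Defined by coordinates, so that the result has dimension \<open>n\<close> for every
  argument and additivity in \<open>p\<close> needs no carrier condition.\<close>

definition poly_op :: "'g fpoly \<Rightarrow> complex vec \<Rightarrow> complex vec" where
  "poly_op p v =
     vec n (\<lambda>i. \<Sum>w\<in>Poly_Mapping.keys p. Poly_Mapping.lookup p w * word_op w v $ i)"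

lemma word_op_endo: "vec_endo n (word_op w)"
proof -
  have "vec_endo n (fold op xs)" for xs
    by (induction xs) (use endo in \<open>auto simp: vec_endo_def\<close>)
  moreover have "word_op w = fold op (letters w)"
    by (auto simp: word_op_def)
  ultimately show ?thesis
    by simp
qed

lemma word_op_zero: "word_op 0 v = v"
  by (simp add: word_op_def zero_fword_def)

lemma word_op_plus: "word_op (u + w) v = word_op w (word_op u v)"
  by (simp add: word_op_def plus_fword_def)

lemma poly_op_closed [simp]: "poly_op p v \<in> carrier_vec n"
  by (simp add: poly_op_def)

lemma dim_poly_op [simp]: "dim_vec (poly_op p v) = n"
  by (simp add: poly_op_def)

lemma poly_op_single:
  assumes "v \<in> carrier_vec n"
  shows "poly_op (Poly_Mapping.single w c) v = c \<cdot>\<^sub>v word_op w v"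
  using vec_endoD(1)[OF word_op_endo assms, of w] by (intro eq_vecI) (auto simp: poly_op_def)

text \<open>Cancellation may shrink the support of \<open>p + q\<close>. This is harmless because
  each summand is additive in the coefficient and vanishes with it.\<close>

lemma poly_op_add: "poly_op (p + q) v = poly_op p v + poly_op q v"
  by (intro eq_vecI)
    (auto simp: poly_op_def distrib_right
      intro!: setsum_keys_plus_distrib[where f = "\<lambda>w c. c * word_op w v $ i" for i])

lemma poly_op_endo: "vec_endo n (poly_op p)"
proof (induction p rule: fpoly_induct)
  case (single w c)
  show ?case
    using word_op_endo[of w]
    by (auto simp: vec_endo_def poly_op_single smult_add_distrib_vec[where n = n] smult_smult_assoc mult.commute)
next
  case (add p q)
  then show ?case
    by (auto simp: vec_endo_def poly_op_add smult_add_distrib_vec[where n = n]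
        intro!: eq_vecI)
qed

text \<open>By additivity both factors may be taken to be monomials, whose product concatenates the
  words; the left factor acts first.\<close>

lemma poly_op_mult:
  assumes "v \<in> carrier_vec n"
  shows "poly_op (p * q) v = poly_op q (poly_op p v)"
proof (induction q rule: fpoly_induct)
  case (single w c)
  show ?case
  proof (induction p rule: fpoly_induct)
    case (single u d)
    show ?case
      using assms
      by (simp add: mult_single poly_op_single word_op_plus vec_endoD[OF word_op_endo]
          smult_smult_assoc mult.commute)
  next
    case (add p p')
    then show ?case
      by (simp add: distrib_right poly_op_add vec_endoD(2)[OF poly_op_endo])
  qed
qed (simp add: distrib_left poly_op_add)

lemma poly_op_fscale:
  assumes "v \<in> carrier_vec n"
  shows "poly_op (fscale c p) v = c \<cdot>\<^sub>v poly_op p v"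
  using assms
  by (simp add: fscale_def poly_op_mult poly_op_single word_op_zero vec_endoD(3)[OF poly_op_endo])

lemma poly_op_one: "v \<in> carrier_vec n \<Longrightarrow> poly_op 1 v = v"
  by (simp add: poly_op_single word_op_zero flip: single_one)

lemma poly_op_free_gen: "v \<in> carrier_vec n \<Longrightarrow> poly_op (free_gen g) v = op g v"
  by (simp add: free_gen_def poly_op_single word_op_def)

lemma poly_op_0: "poly_op 0 v = 0\<^sub>v n"
  by (auto simp: poly_op_def)

lemma poly_op_uminus: "poly_op (- p) v = - poly_op p v"
  by (auto simp: poly_op_def sum_negf)

lemma poly_op_diff: "poly_op (p - q) v = poly_op p v - poly_op q v"
  using poly_op_add[of p "- q" v] by (simp add: poly_op_uminus minus_add_uminus_vec[where n = n])

text \<open>The polynomials acting as zero form a two-sided ideal: one absorption law holds because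
  operators preserve dimension \<open>n\<close>, the other because they send zero to zero. It
  contains \<open>Rel\<close>, hence the generated ideal.\<close>

lemma poly_op_ideal_relations:
  assumes rel: "\<And>p v. p \<in> Rel \<Longrightarrow> v \<in> carrier_vec n \<Longrightarrow> poly_op p v = 0\<^sub>v n"
    and "p \<in> Idl\<^bsub>free_algebra\<^esub> Rel" "v \<in> carrier_vec n"
  shows "poly_op p v = 0\<^sub>v n"
proof -
  let ?F = "free_algebra :: (complex, 'g fpoly) module"
  let ?J = "{p. \<forall>v\<in>carrier_vec n. poly_op p v = 0\<^sub>v n}"
  interpret ring ?F
    by (rule ring_free_algebra)
  have inv: "\<ominus>\<^bsub>?F\<^esub> p = - p" for p
    using minus_equality[of "- p" p] by simp
  have "ideal ?J ?F"
  proof (rule idealI[OF ring_free_algebra])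
    show "subgroup ?J (add_monoid ?F)"
      by (intro add.subgroupI)
        (auto simp: poly_op_add poly_op_uminus inv simp flip: a_inv_def intro!: exI[of _ 0] poly_op_0)
  qed (auto simp: poly_op_mult vec_endo_zero[OF poly_op_endo])
  then have "Idl\<^bsub>?F\<^esub> Rel \<subseteq> ?J"
    by (rule genideal_minimal) (use rel in auto)
  with assms show ?thesis
    by auto
qed

text \<open>The representative is arbitrary; the choice becomes irrelevant once the relations act as
  zero.\<close>

definition coset_op :: "complex vec \<Rightarrow> 'g fpoly set \<Rightarrow> complex vec" where
  "coset_op v A = poly_op (SOME p. p \<in> A) v"

lemma coset_op_presented_coset:
  assumes rel: "\<And>p v. p \<in> Rel \<Longrightarrow> v \<in> carrier_vec n \<Longrightarrow> poly_op p v = 0\<^sub>v n"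
    and v: "v \<in> carrier_vec n"
  shows "coset_op v (presented_coset Rel p) = poly_op p v"
proof -
  let ?F = "free_algebra :: (complex, 'g fpoly) module"
  interpret ideal "Idl\<^bsub>?F\<^esub> Rel" ?F
    by (rule ideal_relations)
  have "p \<in> presented_coset Rel p"
    unfolding presented_coset_def by (rule a_rcos_self) simp
  then have "(SOME q. q \<in> presented_coset Rel p) \<in> presented_coset Rel p"
    by (rule someI)
  \<comment> \<open>The chosen representative differs from \<open>p\<close> by an element of the
    ideal, which acts as zero.\<close>
  then obtain h where "h \<in> Idl\<^bsub>?F\<^esub> Rel" "(SOME q. q \<in> presented_coset Rel p) = h + p"
    by (auto simp: presented_coset_def a_r_coset_def')
  then show ?thesis
    using poly_op_ideal_relations[OF rel _ v] by (simp add: coset_op_def poly_op_add)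
qed

lemma right_module_coset_op:
  assumes rel: "\<And>p v. p \<in> Rel \<Longrightarrow> v \<in> carrier_vec n \<Longrightarrow> poly_op p v = 0\<^sub>v n"
  shows "right_module class_ring (presented_algebra Rel) (module_vec TYPE(complex) n) coset_op"
  by (intro right_module.intro right_module_axioms.intro assoc_algebra_presented_algebra vec_module)
    (auto simp: presented_algebra_simps module_vec_simps coset_op_presented_coset[OF rel]
      poly_op_add poly_op_fscale poly_op_mult poly_op_one vec_endoD[OF poly_op_endo])

lemma coset_op_presented_gen:
  assumes rel: "\<And>p v. p \<in> Rel \<Longrightarrow> v \<in> carrier_vec n \<Longrightarrow> poly_op p v = 0\<^sub>v n"
    and "v \<in> carrier_vec n"
  shows "coset_op v (presented_gen Rel g) = op g v"
  using coset_op_presented_coset[OF assms, where p = "free_gen g"] assms(2)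
  by (simp add: poly_op_free_gen presented_gen_def presented_coset_def)

end


section \<open>Linear maps determined on unit vectors, and weighted cyclic shifts\<close>

lemma vec_linear_induct [consumes 1, case_names zero unit add smult]:
  fixes v :: "complex vec"
  assumes "v \<in> carrier_vec n"
    and "P (0\<^sub>v n)"
    and "\<And>i. i < n \<Longrightarrow> P (unit_vec n i)"
    and "\<And>u v. u \<in> carrier_vec n \<Longrightarrow> v \<in> carrier_vec n \<Longrightarrow> P u \<Longrightarrow> P v \<Longrightarrow> P (u + v)"
    and "\<And>c v. v \<in> carrier_vec n \<Longrightarrow> P v \<Longrightarrow> P (c \<cdot>\<^sub>v v)"
  shows "P v"
proof -
  \<comment> \<open>\<open>u k\<close> keeps the first \<open>k\<close> coordinates, so it grows
    from 0 to \<open>v\<close> by one multiple of a unit vector at a time.\<close>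
  define u where "u k = vec n (\<lambda>i. if i < k then v $ i else 0)" for k
  have "k \<le> n \<Longrightarrow> P (u k)" for k
  proof (induction k)
    case 0
    have "u 0 = 0\<^sub>v n"
      by (auto simp: u_def)
    with assms(2) show ?case
      by simp
  next
    case (Suc k)
    have "u (Suc k) = u k + v $ k \<cdot>\<^sub>v unit_vec n k"
      using Suc.prems by (intro eq_vecI) (auto simp: u_def less_Suc_eq)
    with Suc show ?case
      by (auto simp: u_def intro!: assms(3-5))
  qed
  moreover have "u n = v"
    using assms(1) by (auto simp: u_def)
  ultimately show ?thesis
    by auto
qed

lemma vec_endo_eqI:
  assumes "vec_endo n f" "vec_endo n g" "v \<in> carrier_vec n"
    and "\<And>i. i < n \<Longrightarrow> f (unit_vec n i) = g (unit_vec n i)"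
  shows "f v = g v"
  using assms(3)
proof (induction v rule: vec_linear_induct)
  case zero
  show ?case
    using assms(1,2) by (simp add: vec_endo_zero)
qed (use assms in \<open>auto simp: vec_endo_def\<close>)

text \<open>\<open>wshift n k c\<close> is the linear extension of \<open>e(a) \<mapsto> c(a) e(a \<oplus> k)\<close>.\<close>

definition wshift :: "nat \<Rightarrow> nat \<Rightarrow> (nat \<Rightarrow> complex) \<Rightarrow> complex vec \<Rightarrow> complex vec" where
  "wshift n k c v = vec n (\<lambda>i. \<Sum>a<n. if (a + k) mod n = i then c a * v $ a else 0)"

lemma wshift_closed [simp]: "wshift n k c v \<in> carrier_vec n"
  by (simp add: wshift_def)

lemma wshift_endo: "vec_endo n (wshift n k c)"
  by (auto simp: vec_endo_def wshift_def sum_distrib_left distrib_left if_distrib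
      simp flip: sum.distrib intro!: eq_vecI sum.cong)

lemma add_mod_inj:
  fixes a b k n :: nat
  assumes "(a + k) mod n = (b + k) mod n" "a < n" "b < n"
  shows "a = b"
  using assms
proof (induction a b rule: linorder_wlog)
  case (le a b)
  then have "n dvd (b + k) - (a + k)"
    by (metis add_le_mono1 mod_eq_dvd_iff_nat)
  with le show ?case
    by (auto dest: dvd_imp_le)
qed simp

lemma wshift_index:
  assumes "a < n"
  shows "wshift n k c v $ ((a + k) mod n) = c a * v $ a"
proof -
  have "wshift n k c v $ ((a + k) mod n)
      = (\<Sum>b<n. if (b + k) mod n = (a + k) mod n then c b * v $ b else 0)"
    using assms by (simp add: wshift_def)
  \<comment> \<open>Translation modulo \<open>n\<close> is injective on indices below
    \<open>n\<close>, so a single term survives.\<close>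
  also have "\<dots> = (\<Sum>b<n. if b = a then c b * v $ b else 0)"
    using assms by (intro sum.cong) (auto dest: add_mod_inj)
  finally have "wshift n k c v $ ((a + k) mod n) = (\<Sum>b<n. if b = a then c b * v $ b else 0)" .
  with assms show ?thesis
    by simp
qed

lemma wshift_nonzeroE:
  assumes "wshift n k c v $ i \<noteq> 0" "i < n"
  obtains a where "a < n" "i = (a + k) mod n" "c a \<noteq> 0" "v $ a \<noteq> 0"
proof -
  have "(\<Sum>a<n. if (a + k) mod n = i then c a * v $ a else 0) \<noteq> 0"
    using assms by (simp add: wshift_def)
  then obtain a where "a \<in> {..<n}" "(if (a + k) mod n = i then c a * v $ a else 0) \<noteq> 0"
    by (rule sum.not_neutral_contains_not_neutral)
  then show thesis
    using that by (auto split: if_splits)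
qed

lemma wshift_unit:
  assumes "a < n"
  shows "wshift n k c (unit_vec n a) = c a \<cdot>\<^sub>v unit_vec n ((a + k) mod n)"
proof (rule eq_vecI)
  fix i assume i: "i < dim_vec (c a \<cdot>\<^sub>v unit_vec n ((a + k) mod n) :: complex vec)"
  have "wshift n k c (unit_vec n a) $ i =
      (\<Sum>b<n. if (b + k) mod n = i then c b * unit_vec n a $ b else 0)"
    using i by (simp add: wshift_def)
  also have "\<dots> = (\<Sum>b<n. if b = a then if (a + k) mod n = i then c a else 0 else 0)"
    using assms by (intro sum.cong) auto
  finally have "wshift n k c (unit_vec n a) $ i = \<dots>" .
  with i assms show "wshift n k c (unit_vec n a) $ i = (c a \<cdot>\<^sub>v unit_vec n ((a + k) mod n)) $ i"
    by auto
qed (simp add: wshift_def)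

lemma wshift_cong:
  assumes "k = m" "\<And>a. a < n \<Longrightarrow> c a = d a"
  shows "wshift n k c v = wshift n m d v"
  unfolding wshift_def using assms by (intro arg_cong[of _ _ "vec n"] ext sum.cong) auto

lemma wshift_add: "wshift n k c v + wshift n k d v = wshift n k (\<lambda>a. c a + d a) v"
proof (rule eq_vecI)
  fix i assume "i < dim_vec (wshift n k (\<lambda>a. c a + d a) v)"
  then have "i < n"
    by (simp add: wshift_def)
  then have "(wshift n k c v + wshift n k d v) $ i =
      (\<Sum>a<n. if (a + k) mod n = i then c a * v $ a else 0) +
      (\<Sum>a<n. if (a + k) mod n = i then d a * v $ a else 0)"
    by (simp add: wshift_def)
  also have "\<dots> = (\<Sum>a<n. if (a + k) mod n = i then (c a + d a) * v $ a else 0)"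
    unfolding sum.distrib[symmetric] by (rule sum.cong) (auto simp: distrib_right)
  finally show "(wshift n k c v + wshift n k d v) $ i = wshift n k (\<lambda>a. c a + d a) v $ i"
    using \<open>i < n\<close> by (simp add: wshift_def)
qed (simp add: wshift_def)

lemma wshift_smult: "x \<cdot>\<^sub>v wshift n k c v = wshift n k (\<lambda>a. x * c a) v"
proof (rule eq_vecI)
  fix i assume "i < dim_vec (wshift n k (\<lambda>a. x * c a) v)"
  then have "i < n"
    by (simp add: wshift_def)
  then have "(x \<cdot>\<^sub>v wshift n k c v) $ i
      = x * (\<Sum>a<n. if (a + k) mod n = i then c a * v $ a else 0)"
    by (simp add: wshift_def)
  also have "\<dots> = (\<Sum>a<n. if (a + k) mod n = i then x * c a * v $ a else 0)"
    unfolding sum_distrib_left by (rule sum.cong) auto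
  finally show "(x \<cdot>\<^sub>v wshift n k c v) $ i = wshift n k (\<lambda>a. x * c a) v $ i"
    using \<open>i < n\<close> by (simp add: wshift_def)
qed (simp add: wshift_def)

text \<open>The operator applied second reads its weight at an index already shifted by
  \<open>m\<close> and reduced modulo \<open>n\<close>; this is why periodic weights are needed
  later.\<close>

lemma wshift_wshift:
  assumes "v \<in> carrier_vec n"
  shows "wshift n k c (wshift n m d v) = wshift n (m + k) (\<lambda>a. d a * c ((a + m) mod n)) v"
proof (rule vec_endo_eqI[OF _ wshift_endo assms])
  show "vec_endo n (\<lambda>v. wshift n k c (wshift n m d v))"
    using wshift_endo[of n k c] wshift_endo[of n m d] by (simp add: vec_endo_def)
  fix i assume "i < n"
  then show "wshift n k c (wshift n m d (unit_vec n i))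
      = wshift n (m + k) (\<lambda>a. d a * c ((a + m) mod n)) (unit_vec n i)"
    using wshift_endo[of n k c]
    by (simp add: wshift_unit vec_endo_def smult_smult_assoc mod_add_left_eq add.assoc)
qed

text \<open>A vector of \<open>N\<close> of minimal support is a multiple of some \<open>e(i)\<close>: an operator whose weight
  vanishes at one point of the support but not at another produces a nonzero vector of smaller
  support.\<close>

lemma wshift_invariant_submodule:
  assumes N: "LinearCombinations.submodule class_ring N (module_vec TYPE(complex) n)"
    and sep: "\<And>i j. i < n \<Longrightarrow> j < n \<Longrightarrow> i \<noteq> j \<Longrightarrow>
      \<exists>k c. c i = 0 \<and> c j \<noteq> 0 \<and> (\<forall>v\<in>N. wshift n k c v \<in> N)"
    and shift: "\<And>v. v \<in> N \<Longrightarrow> wshift n 1 (\<lambda>_. 1) v \<in> N"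
  shows "N = {0\<^sub>v n} \<or> N = carrier_vec n"
proof -
  interpret N: LinearCombinations.submodule class_ring N "module_vec TYPE(complex) n"
    by (rule N)
  have carr: "v \<in> carrier_vec n" if "v \<in> N" for v
    using N.subset that by (auto simp: module_vec_simps)
  define supp where "supp v = {i. i < n \<and> v $ i \<noteq> 0}" for v :: "complex vec"
  have fin: "finite (supp v)" for v
    by (simp add: supp_def)
  have supp_nonempty: "supp v \<noteq> {}" if "v \<in> N" "v \<noteq> 0\<^sub>v n" for v
    using that carr[of v] by (auto simp: supp_def)
  show ?thesis
  proof (cases "N = {0\<^sub>v n}")
    case False
    then have "\<exists>v. v \<in> N \<and> v \<noteq> 0\<^sub>v n"
      using N.zero_closed by (auto simp: module_vec_simps)
    then obtain v where v: "v \<in> N" "v \<noteq> 0\<^sub>v n"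
      and min: "\<And>u. u \<in> N \<and> u \<noteq> 0\<^sub>v n \<Longrightarrow> card (supp v) \<le> card (supp u)"
      using ex_has_least_nat[of "\<lambda>v. v \<in> N \<and> v \<noteq> 0\<^sub>v n" _ "\<lambda>v. card (supp v)"] by metis
    obtain j where j: "j \<in> supp v"
      using supp_nonempty[OF v] by auto
    have "supp v = {j}"
    proof (rule ccontr)
      assume "supp v \<noteq> {j}"
      with j obtain i where i: "i \<in> supp v" "i \<noteq> j"
        by auto
      with j sep[of i j] obtain k c where c: "c i = 0" "c j \<noteq> 0" "wshift n k c v \<in> N"
        using v(1) by (auto simp: supp_def)
      \<comment> \<open>No other entry lands on the image of \<open>j\<close>, so its nonzero value
        is not cancelled.\<close>
      have "wshift n k c v $ ((j + k) mod n) \<noteq> 0"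
        using j c by (simp add: supp_def wshift_index)
      moreover have "(j + k) mod n < n"
        using j by (auto simp: supp_def)
      ultimately have "wshift n k c v \<noteq> 0\<^sub>v n"
        by auto
      with min c have "card (supp v) \<le> card (supp (wshift n k c v))"
        by blast
      \<comment> \<open>Nonzero entries arise only from points of \<open>supp v\<close> with nonzero
        weight, which excludes \<open>i\<close>; moving indices cannot increase their
        number.\<close>
      also have "supp (wshift n k c v) \<subseteq> (\<lambda>a. (a + k) mod n) ` (supp v - {i})"
      proof
        fix b assume "b \<in> supp (wshift n k c v)"
        then obtain a where "a < n" "b = (a + k) mod n" "c a \<noteq> 0" "v $ a \<noteq> 0"
          by (auto simp: supp_def elim: wshift_nonzeroE)
        with c show "b \<in> (\<lambda>a. (a + k) mod n) ` (supp v - {i})"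
          by (auto simp: supp_def)
      qed
      then have "card (supp (wshift n k c v)) \<le> card (supp v - {i})"
        using fin by (meson card_image_le card_mono finite_Diff finite_imageI le_trans)
      also have "\<dots> < card (supp v)"
        using i fin by (meson card_Diff1_less)
      finally show False
        by simp
    qed
    then have "v $ i = 0" if "i < n" "i \<noteq> j" for i
      using that unfolding supp_def by blast
    moreover have jn: "j < n" "v $ j \<noteq> 0"
      using j by (simp_all add: supp_def)
    ultimately have "inverse (v $ j) \<cdot>\<^sub>v v = unit_vec n j"
      using carr[OF v(1)] by (intro eq_vecI) auto
    then have unit_j: "unit_vec n j \<in> N"
      using N.smult_closed[of "inverse (v $ j)" v] v(1) by (simp add: module_vec_simps)
    have orbit: "unit_vec n ((j + m) mod n) \<in> N" for m
    proof (induction m)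
      case 0
      then show ?case
        using unit_j jn by simp
    next
      case (Suc m)
      then show ?case
        using shift[OF Suc] jn by (simp add: wshift_unit mod_Suc_eq)
    qed
    have units: "unit_vec n i \<in> N" if "i < n" for i
    proof -
      \<comment> \<open>Going from \<open>j\<close> up to \<open>n\<close> and then \<open>i\<close>
        further steps around the cycle avoids a case split on the order of \<open>i\<close> and
        \<open>j\<close>.\<close>
      have "(j + (n - j + i)) mod n = i"
        using that jn by simp
      then show ?thesis
        using orbit[of "n - j + i"] by simp
    qed
    have "v \<in> N" if "v \<in> carrier_vec n" for v
      using that
      by (induction v rule: vec_linear_induct)
        (use units N.m_closed N.smult_closed N.zero_closed in \<open>auto simp: module_vec_simps\<close>)
    with carr show ?thesis
      by auto
  qed simp
qed

section \<open>Orders of roots of unity and the number \<open>ell r s\<close>\<close>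

lemma mult_order_dvd_iff:
  assumes "z \<noteq> 0"
  shows "mult_order z dvd m \<longleftrightarrow> z ^ m = 1"
  using group.pow_eq_id[OF field.field_mult_group[OF class_field], of z m] assms
  by (simp add: mult_order_def nat_pow_mult_of class_ring_simps)

lemma root_of_unity_mult:
  assumes "root_of_unity x" "root_of_unity y"
  shows "root_of_unity (x * y)"
proof -
  obtain m k where "m > 0" "x ^ m = 1" "k > 0" "y ^ k = 1"
    using assms by (auto simp: root_of_unity_def)
  moreover have "(x * y) ^ (m * k) = (x ^ m) ^ k * (y ^ k) ^ m"
    by (metis mult.commute power_mult power_mult_distrib)
  ultimately have "(x * y) ^ (m * k) = 1" "m * k > 0"
    by simp_all
  then show ?thesis
    unfolding root_of_unity_def by blast
qed

lemma root_of_unity_inverse: "root_of_unity x \<Longrightarrow> root_of_unity (inverse x)"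
  by (auto simp: root_of_unity_def power_inverse)

text \<open>An order of 0 would divide only the exponent 0, whereas a root of unity has a positive
  exponent.\<close>

lemma mult_order_pos:
  assumes "z \<noteq> 0" "root_of_unity z"
  shows "mult_order z > 0"
  using assms mult_order_dvd_iff[of z] by (metis dvd_0_left_iff gr0I root_of_unity_def)

lemma power_eq_imp_mult_order_dvd:
  assumes "z \<noteq> 0" "z ^ i = z ^ j" "i \<le> j"
  shows "mult_order z dvd j - i"
  using assms by (simp add: mult_order_dvd_iff power_diff)

text \<open>Removes the reduced indices that \<open>wshift_wshift\<close> puts into
  exponents.\<close>

lemma power_mod_period:
  fixes z :: "'a::monoid_mult"
  assumes "z ^ n = 1"
  shows "z ^ (m mod n) = z ^ m"
proof -
  have "z ^ m = z ^ (n * (m div n) + m mod n)"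
    by simp
  also have "\<dots> = z ^ (m mod n)"
    using assms by (simp only: power_add power_mult) simp
  finally show ?thesis ..
qed

text \<open>Gives the weight of \<open>X_1\<close> the same shape, a natural power of a fixed base,
  as the other weights.\<close>

lemma powi_neg_two: "s powi (-2 * int a) = inverse (s\<^sup>2) ^ a"
  for s :: complex
  by (simp add: power_int_minus power_int_def nat_mult_distrib power_inverse flip: power_mult)

context
  fixes r s :: complex
  assumes nz: "r \<noteq> 0" "s \<noteq> 0"
begin

lemma ell_power:
  "(r * s) ^ ell r s = 1" "(r * inverse s) ^ ell r s = 1" "inverse (s\<^sup>2) ^ ell r s = 1"
proof -
  show *: "(r * s) ^ ell r s = 1" "(r * inverse s) ^ ell r s = 1"
    using nz mult_order_dvd_iff[of "r * s" "ell r s"] mult_order_dvd_iff[of "r * inverse s" "ell r s"]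
    by (simp_all add: ell_def)
  have "inverse (s\<^sup>2) = (r * inverse s) * inverse (r * s)"
    using nz by (simp add: field_simps power2_eq_square)
  then have "inverse (s\<^sup>2) ^ ell r s = (r * inverse s) ^ ell r s * inverse ((r * s) ^ ell r s)"
    by (simp only: power_mult_distrib power_inverse)
  with * show "inverse (s\<^sup>2) ^ ell r s = 1"
    by simp
qed

lemma ell_pos:
  assumes "root_of_unity r" "root_of_unity s"
  shows "ell r s > 0"
  using assms nz mult_order_pos[of "r * s"] mult_order_pos[of "r * inverse s"]
  by (simp add: ell_def lcm_pos_nat root_of_unity_mult root_of_unity_inverse)

text \<open>Both orders divide \<open>j - i\<close>, hence so does their lcm; but
  \<open>j - i\<close> is smaller than that lcm.\<close>

lemma ell_separates:
  assumes "i < ell r s" "j < ell r s"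
    and "(r * s) ^ i = (r * s) ^ j" "(r * inverse s) ^ i = (r * inverse s) ^ j"
  shows "i = j"
  using assms
proof (induction i j rule: linorder_wlog)
  case (le i j)
  then have "ell r s dvd j - i"
    unfolding ell_def using nz by (intro lcm_least power_eq_imp_mult_order_dvd) auto
  with le show ?case
    by (auto dest: dvd_imp_le)
qed simp

end

section \<open>The operators of \<open>M_3\<close> and the defining relations of
  \<open>B\<close>\<close>

context
  fixes r s \<epsilon>1 \<epsilon>2 \<epsilon>3 :: complex
begin

text \<open>The weights are those of \<open>is_M3\<close> verbatim, so comparing the two only takes
  \<open>wshift_unit\<close>.\<close>

primrec M3_op :: "B_letter \<Rightarrow> complex vec \<Rightarrow> complex vec" where
  "M3_op LX1 = wshift (ell r s) 2 (\<lambda>a. \<epsilon>1^2 * \<epsilon>3 * inverse \<epsilon>2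
     * ((1 - r * inverse s) / (s^2 * (r^2 - s^2))) * s powi (-2 * int a))"
| "M3_op LX2 = wshift (ell r s) 1 (\<lambda>a. \<epsilon>1)"
| "M3_op LX3 = wshift (ell r s) 0 (\<lambda>a. (r * s)^a * \<epsilon>2)"
| "M3_op LW = wshift (ell r s) 1 (\<lambda>a. \<epsilon>1 * \<epsilon>3 * (r * inverse s)^a)"

lemma M3_op_endo: "vec_endo (ell r s) (M3_op g)"
  by (cases g) (simp_all add: wshift_endo)

interpretation letter_action "ell r s" M3_op
  by standard (rule M3_op_endo)

lemma M3_relations:
  assumes nz: "r \<noteq> 0" "s \<noteq> 0" "\<epsilon>2 \<noteq> 0" "r^2 \<noteq> s^2"
    and "p \<in> B_relations r s" and v: "v \<in> carrier_vec (ell r s)"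
  shows "poly_op p v = 0\<^sub>v (ell r s)"
proof -
  define x y z K where "x = r * s" and "y = r * inverse s" and "z = inverse (s^2)"
    and "K = \<epsilon>1^2 * \<epsilon>3 * inverse \<epsilon>2 * ((1 - y) / (s^2 * (r^2 - s^2)))"
  have X1: "M3_op LX1 = wshift (ell r s) 2 (\<lambda>a. K * z ^ a)"
    by (simp only: M3_op.simps K_def y_def z_def powi_neg_two)
  have X3: "M3_op LX3 = wshift (ell r s) 0 (\<lambda>a. x ^ a * \<epsilon>2)"
    by (simp add: x_def)
  have W: "M3_op LW = wshift (ell r s) 1 (\<lambda>a. \<epsilon>1 * \<epsilon>3 * y ^ a)"
    by (simp add: y_def)
  note op = X1 M3_op.simps(2) X3 W
  have period: "x ^ (m mod ell r s) = x ^ m" "y ^ (m mod ell r s) = y ^ m"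
    "z ^ (m mod ell r s) = z ^ m" for m
    using ell_power[OF nz(1,2), THEN power_mod_period] by (simp_all add: x_def y_def z_def)
  \<comment> \<open>After cancelling common factors, these are the weight identities behind the
    relations of \<open>X_1\<close> with \<open>W\<close>, \<open>X_2\<close>, \<open>X_3\<close>
    and of \<open>X_3\<close> with \<open>X_2\<close>, in this order.\<close>
  have scalars: "r powi (-2) * (y * y) = z" "s powi (-2) = z" "x powi (-2) * (x * x) = 1"
    "x powi (-1) * x = 1"
    using nz by (simp_all add: x_def y_def z_def power_int_minus field_simps power2_eq_square)
  have y_power: "y ^ a = x ^ a * z ^ a" for a
    using nz by (simp add: x_def y_def z_def field_simps power2_eq_square flip: power_mult_distrib)
  \<comment> \<open>This explains the coefficient of \<open>X_1\<close>: \<open>W X_2\<close> and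
    \<open>X_2 W\<close> have weights \<open>\<epsilon>1^2 * \<epsilon>3 * y^a\<close> and
    \<open>y\<close> times that, and \<open>K\<close> is chosen so that \<open>X_3 X_1\<close> makes
    up the difference, using \<open>y = x * z\<close>.\<close>
  have "s^2 * (r^2 - s^2) * (\<epsilon>2 * K) = \<epsilon>1^2 * \<epsilon>3 * (1 - y)"
    using nz by (simp add: K_def)
  then have K: "s^2 * (r^2 - s^2) * (x ^ a * \<epsilon>2 * (K * z ^ a)) = \<epsilon>1^2 * \<epsilon>3 * (1 - y) * y ^ a" for a
    by (simp add: y_power mult_ac)
  note simps = op wshift_wshift[OF v] wshift_smult wshift_add period power_add
  \<comment> \<open>Since the action is on the right, the product \<open>W * X1\<close> applies
    \<open>W\<close> first, and the compositions appear in reverse order.\<close>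
  have
    "M3_op LX1 (M3_op LW v) = r powi (-2) \<cdot>\<^sub>v M3_op LW (M3_op LX1 v)"
    "M3_op LX1 (M3_op LX2 v) = s powi (-2) \<cdot>\<^sub>v M3_op LX2 (M3_op LX1 v)"
    "M3_op LX1 (M3_op LX3 v) = x powi (-2) \<cdot>\<^sub>v M3_op LX3 (M3_op LX1 v)"
    "M3_op LX2 (M3_op LX3 v) = x powi (-1) \<cdot>\<^sub>v M3_op LX3 (M3_op LX2 v)"
    "M3_op LX3 (M3_op LW v) = x \<cdot>\<^sub>v M3_op LW (M3_op LX3 v)"
    "M3_op LX2 (M3_op LW v) =
       M3_op LW (M3_op LX2 v) + (s^2 * (r^2 - s^2)) \<cdot>\<^sub>v M3_op LX1 (M3_op LX3 v)"
  proof -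
    show "M3_op LX1 (M3_op LW v) = r powi (-2) \<cdot>\<^sub>v M3_op LW (M3_op LX1 v)"
      unfolding simps by (rule wshift_cong) (auto simp: mult_ac power2_eq_square simp flip: scalars(1))
    show "M3_op LX1 (M3_op LX2 v) = s powi (-2) \<cdot>\<^sub>v M3_op LX2 (M3_op LX1 v)"
      unfolding simps scalars(2) by (rule wshift_cong) auto
    show "M3_op LX1 (M3_op LX3 v) = x powi (-2) \<cdot>\<^sub>v M3_op LX3 (M3_op LX1 v)"
      unfolding simps using scalars(3) by (intro wshift_cong) (auto simp: algebra_simps power2_eq_square)
    show "M3_op LX2 (M3_op LX3 v) = x powi (-1) \<cdot>\<^sub>v M3_op LX3 (M3_op LX2 v)"
      unfolding simps using scalars(4) by (intro wshift_cong) (auto simp: algebra_simps)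
    show "M3_op LX3 (M3_op LW v) = x \<cdot>\<^sub>v M3_op LW (M3_op LX3 v)"
      unfolding simps by (rule wshift_cong) auto
    \<comment> \<open>The shift lengths \<open>1 + 1\<close> and \<open>0 + 2\<close> are normalised
      to 2 so that \<open>wshift_add\<close> can merge the two summands.\<close>
    show "M3_op LX2 (M3_op LW v) =
       M3_op LW (M3_op LX2 v) + (s^2 * (r^2 - s^2)) \<cdot>\<^sub>v M3_op LX1 (M3_op LX3 v)"
      unfolding simps add_0 one_add_one wshift_add power_0 mult_1_right K
      by (rule wshift_cong) (auto simp: algebra_simps power2_eq_square)
  qed
  moreover have "u - w = 0\<^sub>v n" if "u = w" "w \<in> carrier_vec n" for u w :: "complex vec" and n
    using that by auto
  ultimately show ?thesis
    using assms(5) v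
    by (auto simp del: M3_op.simps simp: vec_endoD(1)[OF M3_op_endo]
        B_relations_def Let_def poly_op_diff poly_op_add poly_op_mult poly_op_fscale
        poly_op_free_gen x_def)
qed

end

section \<open>Existence, dimension and simplicity of \<open>M_3\<close>\<close>

theorem theorem5p4:
  fixes r s \<epsilon>1 \<epsilon>2 \<epsilon>3 :: complex
  assumes "r \<noteq> 0" and "s \<noteq> 0"
    and "root_of_unity r" and "root_of_unity s"
    and "r^2 \<noteq> s^2"
    and "\<epsilon>1 \<noteq> 0" and "\<epsilon>2 \<noteq> 0" and "\<epsilon>3 \<noteq> 0"
  shows "(\<exists>act. is_M3 r s \<epsilon>1 \<epsilon>2 \<epsilon>3 act) \<and>
    (\<forall>act. is_M3 r s \<epsilon>1 \<epsilon>2 \<epsilon>3 act \<longrightarrow>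
       simple_right_module class_ring (B_alg r s) (M3_space r s) act) \<and>
    vectorspace.dim class_ring (M3_space r s) = ell r s"
proof (intro conjI allI impI)
  let ?n = "ell r s"
  let ?op = "M3_op r s \<epsilon>1 \<epsilon>2 \<epsilon>3"
  interpret L: letter_action ?n ?op
    by standard (rule M3_op_endo)
  note rel = M3_relations[OF assms(1,2,7,5)]
  have mod: "right_module class_ring (B_alg r s) (M3_space r s) L.coset_op"
    unfolding B_alg_def M3_space_def by (rule L.right_module_coset_op) (rule rel)
  have gen: "L.coset_op v (B_gen r s g) = ?op g v" if "v \<in> carrier_vec ?n" for v g
    unfolding B_gen_def using that by (intro L.coset_op_presented_gen rel)
  have "is_M3 r s \<epsilon>1 \<epsilon>2 \<epsilon>3 L.coset_op"
    unfolding is_M3_def Let_def by (simp add: mod gen wshift_unit)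
  then show "\<exists>act. is_M3 r s \<epsilon>1 \<epsilon>2 \<epsilon>3 act"
    by blast
  show "vectorspace.dim class_ring (M3_space r s) = ?n"
    unfolding M3_space_def by (rule vec_space.dim_is_n)
  fix act
  assume act: "is_M3 r s \<epsilon>1 \<epsilon>2 \<epsilon>3 act"
  then have "right_module class_ring (B_alg r s) (M3_space r s) act"
    by (simp add: is_M3_def)
  then interpret right_module class_ring "B_alg r s" "M3_space r s" act .
  have gen_carrier: "B_gen r s g \<in> carrier (B_alg r s)" for g
    by (auto simp: B_gen_def B_alg_def presented_algebra_simps presented_gen_def presented_coset_def)
  have endo: "vec_endo ?n (\<lambda>v. act v (B_gen r s g))" for g
    using act_closed[OF _ gen_carrier] act_add_left[OF _ _ gen_carrier]
      act_smult_left[OF _ _ gen_carrier]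
    by (simp add: vec_endo_def M3_space_def module_vec_simps)
  \<comment> \<open>Both sides are linear and agree on unit vectors, so any admissible
    \<open>act\<close> is given on generators by the explicit shifts.\<close>
  have act_gen: "act v (B_gen r s g) = ?op g v" if "v \<in> carrier_vec ?n" for v g
  proof (rule vec_endo_eqI[OF endo M3_op_endo that])
    fix a assume "a < ?n"
    then show "act (unit_vec ?n a) (B_gen r s g) = ?op g (unit_vec ?n a)"
      using act by (cases g) (simp_all add: is_M3_def Let_def wshift_unit)
  qed
  show "simple_right_module class_ring (B_alg r s) (M3_space r s) act"
  proof (intro simple_right_module.intro simple_right_module_axioms.intro right_module_axioms)
    \<comment> \<open>The root-of-unity hypotheses enter here, through \<open>ell_pos\<close>: the
      module is nonzero because \<open>ell r s\<close> is positive.\<close>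
    have "unit_vec ?n 0 \<noteq> (0\<^sub>v ?n :: complex vec)"
      by (rule unit_vec_nonzero) (rule ell_pos[OF assms(1-4)])
    then show "carrier (M3_space r s) \<noteq> {\<zero>\<^bsub>M3_space r s\<^esub>}"
      unfolding M3_space_def module_vec_simps by (metis singletonD unit_vec_carrier)
    fix N assume N: "right_submodule class_ring (B_alg r s) (M3_space r s) act N"
    then have sub: "LinearCombinations.submodule class_ring N (module_vec TYPE(complex) ?n)"
      by (simp add: right_submodule_def M3_space_def)
    interpret N: LinearCombinations.submodule class_ring N "module_vec TYPE(complex) ?n"
      by (rule sub)
    have comb: "x \<cdot>\<^sub>v u + y \<cdot>\<^sub>v v \<in> N" if "u \<in> N" "v \<in> N" for u v x y
      using that N.m_closed N.smult_closed by (simp add: module_vec_simps)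
    have op: "?op g v \<in> N" if "v \<in> N" for g v
    proof -
      have "act v (B_gen r s g) \<in> N"
        using N that gen_carrier by (auto simp: right_submodule_def)
      moreover have "v \<in> carrier_vec ?n"
        using N.subset that by (auto simp: module_vec_simps)
      ultimately show ?thesis
        by (simp add: act_gen)
    qed
    \<comment> \<open>\<open>X_2\<close> has constant weight \<open>\<epsilon>1\<close>; dividing by
      it leaves the plain shift. The second summand of \<open>comb\<close> is given coefficient
      0.\<close>
    have shift: "wshift ?n 1 (\<lambda>_. 1) v \<in> N" if "v \<in> N" for v
      using comb[OF op[OF that, of LX2] op[OF that, of LX2], of "inverse \<epsilon>1" 0] assms(6)
      by (simp add: wshift_smult wshift_add)
    \<comment> \<open>Subtracting \<open>y\<close> times the plain shift of the same length produces
      a weight that vanishes exactly where \<open>c\<close> takes the value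
      \<open>y\<close>.\<close>
    have diff: "wshift ?n k (\<lambda>a. c a - y) v \<in> N"
      if "wshift ?n k (\<lambda>a. x * c a) v \<in> N" "wshift ?n k (\<lambda>_. 1) v \<in> N" "x \<noteq> 0" for k c x y v
      using comb[OF that(1,2), of "inverse x" "- y"] that(3)
      by (simp add: wshift_smult wshift_add flip: mult.assoc)
    have X3: "wshift ?n 0 (\<lambda>a. (r * s)^a - (r * s)^i) v \<in> N" if "v \<in> N" for v i
    proof (rule diff[OF _ _ assms(7)])
      show "wshift ?n 0 (\<lambda>a. \<epsilon>2 * (r * s)^a) v \<in> N"
        using op[OF that, of LX3] by (simp add: mult.commute[of _ "\<epsilon>2"])
      \<comment> \<open>For length 0 the plain shift is the identity, so \<open>diff\<close> yields
        the operator of \<open>X_3\<close> minus a scalar, up to a factor.\<close>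
      have "wshift ?n 0 (\<lambda>_. 1) v = v"
      proof (rule vec_endo_eqI[OF wshift_endo, of _ "\<lambda>v. v"])
      qed (use that N.subset in \<open>auto simp: vec_endo_def wshift_unit module_vec_simps\<close>)
      with that show "wshift ?n 0 (\<lambda>_. 1) v \<in> N"
        by simp
    qed
    \<comment> \<open>Here the plain shift is \<open>X_2\<close> up to a factor, so this is a
      multiple of \<open>W - \<epsilon>3 (r/s)^i X_2\<close>.\<close>
    have W: "wshift ?n 1 (\<lambda>a. (r * inverse s)^a - (r * inverse s)^i) v \<in> N" if "v \<in> N" for v i
      by (rule diff[OF _ shift[OF that], of "\<epsilon>1 * \<epsilon>3"])
        (use op[OF that, of LW] assms(6,8) in simp_all)
    have "N = {0\<^sub>v ?n} \<or> N = carrier_vec ?n"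
    proof (rule wshift_invariant_submodule[OF sub _ shift])
      fix i j assume ij: "i < ?n" "j < ?n" "i \<noteq> j"
      show "\<exists>k c. c i = 0 \<and> c j \<noteq> 0 \<and> (\<forall>v\<in>N. wshift ?n k c v \<in> N)"
      \<comment> \<open>If the powers of \<open>r * s\<close> do not separate \<open>i\<close> from
        \<open>j\<close>, those of \<open>r * inverse s\<close> must, and the matching operator has
        weight 0 at \<open>i\<close> only among the two.\<close>
      proof (cases "(r * s)^j = (r * s)^i")
        case True
        then have "(r * inverse s)^j \<noteq> (r * inverse s)^i"
          using ell_separates[OF assms(1,2) ij(1,2)] ij(3) by metis
        then show ?thesis
          using W[of _ i] by (intro exI[of _ 1] exI[of _ "\<lambda>a. (r * inverse s)^a - (r * inverse s)^i"]) auto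
      next
        case False
        then show ?thesis
          using X3[of _ i] by (intro exI[of _ 0] exI[of _ "\<lambda>a. (r * s)^a - (r * s)^i"]) auto
      qed
    qed
    then show "N = {\<zero>\<^bsub>M3_space r s\<^esub>} \<or> N = carrier (M3_space r s)"
      by (simp add: M3_space_def module_vec_simps)
  qed
qed

end
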